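(* For every prime power $q$ and every integer $m\ge 1$, a $4m$-dimensional symplectic space over $\mathbb{F}_q$ (an ${\rm Sp}(4m,q)$-space) has a maximal symplectic partial spread of size $q^{2m}-q^m+\gcd(2,q-1)$.
   Context: An ${\rm Sp}(2n,q)$-space is a $2n$-dimensional vector space over $\mathbb{F}_q$ equipped with a nondegenerate alternating bilinear form; a subspace is totally isotropic (t.i.) if the form vanishes identically on it. A symplectic partial spread of an ${\rm Sp}(2n,q)$-space is a set of t.i. $n$-dimensional subspaces any two of which intersect only in $0$. It is maximal if it is not properly contained in another symplectic partial spread of the same space. *)

theory Defs
  imports Complex_Main "HOL-Library.Cardinality"
begin

text \<open>
  The vector space is the whole type \<^typ>\<open>'b\<close>, with scalars in the finite field \<^typ>\<open>'a\<close> of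
  order \<open>q\<close>.  The parameter \<open>n\<close> is half the dimension, as in \<open>Sp(2n,q)\<close>.  The assumption of a
  finite spanning set is needed because \<^term>\<open>vector_space.dim\<close> is also \<open>0\<close> for
  infinite-dimensional spaces.
\<close>

locale Sp_space = vector_space scale
  for scale :: "'a::{field,finite} \<Rightarrow> 'b::ab_group_add \<Rightarrow> 'b" +
  fixes form :: "'b \<Rightarrow> 'b \<Rightarrow> 'a" and n q :: nat
  assumes field_order: "CARD('a) = q"
    and finite_spanning: "\<exists>A. finite A \<and> span A = UNIV"
    and dim_space: "dim UNIV = 2 * n"
    and form_linear_right: "\<And>x. Vector_Spaces.linear scale (*) (\<lambda>y. form x y)"
    and form_linear_left: "\<And>y. Vector_Spaces.linear scale (*) (\<lambda>x. form x y)"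
    and form_alternating: "\<And>x. form x x = 0"
    and form_nondegenerate: "\<And>x. (\<And>y. form x y = 0) \<Longrightarrow> x = 0"
begin

definition totally_isotropic :: "'b set \<Rightarrow> bool" where
  "totally_isotropic U \<longleftrightarrow> (\<forall>x\<in>U. \<forall>y\<in>U. form x y = 0)"

definition symplectic_partial_spread :: "'b set set \<Rightarrow> bool" where
  "symplectic_partial_spread S \<longleftrightarrow>
     (\<forall>U\<in>S. subspace U \<and> dim U = n \<and> totally_isotropic U) \<and>
     (\<forall>U\<in>S. \<forall>W\<in>S. U \<noteq> W \<longrightarrow> U \<inter> W = {0})"

definition maximal_symplectic_partial_spread :: "'b set set \<Rightarrow> bool" where
  "maximal_symplectic_partial_spread S \<longleftrightarrow>
     symplectic_partial_spread S \<and> \<not> (\<exists>T. symplectic_partial_spread T \<and> S \<subset> T)"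

end

end

theory Submission
  imports Defs "HOL-Library.Product_Plus" "HOL-Algebra.Algebraic_Closure_Type"
begin

text \<open>
  Let \<open>L \<subset> K\<close> be the fields of order \<open>q^m\<close> and \<open>q^(2m)\<close>, and let \<open>a \<noteq> 0\<close> in \<open>K\<close> have relative
  trace \<open>0\<close> to \<open>L\<close>.  Symplectic spaces of equal dimension are isometric, so the space may be taken to
  be \<open>K\<^sup>2\<close> with the form \<open>Tr (a det (v, w))\<close>.  Its points over \<open>K\<close> form a symplectic spread, and the
  choice of \<open>a\<close> makes \<open>L\<^sup>2\<close> totally isotropic.  Delete the \<open>q^m + 1\<close> points meeting \<open>L\<^sup>2\<close> and add
  \<open>L\<^sup>2\<close> and \<open>a L\<^sup>2\<close>, which coincide exactly when \<open>q\<close> is even.  If a totally isotropic subspace \<open>U\<close> of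
  the right size meets all these members trivially, then \<open>U\<close> lies in the union of the deleted points.
  Adding two vectors of \<open>U\<close> in different points shows that their multipliers with respect to \<open>L\<^sup>2\<close>
  agree modulo \<open>L\<close>, hence \<open>U = k L\<^sup>2\<close> for some \<open>k\<close>; total isotropy then forces \<open>conj k = k\<close> or
  \<open>conj k = - k\<close>, so \<open>U\<close> is \<open>L\<^sup>2\<close> or \<open>a L\<^sup>2\<close>.
\<close>

section \<open>Subfields of the algebraic closure of a finite field\<close>

text \<open>A nonzero \<open>p\<close> splits into \<open>degree p\<close> linear factors; a root of
  order at least 2 would also be a root of \<open>pderiv p\<close>, so the factors are
  distinct.\<close>

lemma card_roots_of_separable:
  fixes p :: "'a::alg_closed_field poly"
  assumes "p \<noteq> 0" and sep: "\<And>x. poly p x = 0 \<Longrightarrow> poly (pderiv p) x \<noteq> 0"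
  shows "card {x. poly p x = 0} = degree p"
proof -
  obtain A where A: "size A = degree p" "p = smult (lead_coeff p) (\<Prod>x\<in>#A. [:-x, 1:])"
    using alg_closed_imp_factorization[OF assms(1)] by blast
  have "proots p = proots (\<Prod>x\<in>#A. [:-x, 1:])"
    using A(2) assms(1) by (metis leading_coeff_0_iff proots_smult)
  also have "\<dots> = (\<Sum>x\<in>#A. proots [:-x, 1:])"
    using proots_prod_mset[of "image_mset (\<lambda>x. [:-x, 1:]) A"]
    by (force simp: image_mset.compositionality o_def)
  also have "\<dots> = A"
    by (induction A) auto
  finally have size: "size (proots p) = degree p"
    using A(1) by simp
  have simple: "order x p = 1" if x: "poly p x = 0" for x
  proof -
    have "order x p \<noteq> 0"
      using x assms(1) by (simp add: order_root)
    moreover have "\<not> 2 \<le> order x p"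
    proof
      assume "2 \<le> order x p"
      then have "[:-x, 1:] ^ 2 dvd p"
        by (simp add: order_divides)
      then obtain r where "p = [:-x, 1:] * ([:-x, 1:] * r)"
        unfolding power2_eq_square mult.assoc by (elim dvdE) (simp only: mult.assoc)
      then have "poly (pderiv p) x = 0"
        by (simp only: pderiv_mult poly_add poly_mult) simp
      then show False
        using sep[OF x] by simp
    qed
    ultimately show ?thesis by linarith
  qed
  have "proots p = mset_set {x. poly p x = 0}"
    using assms(1) simple poly_roots_finite[OF assms(1)]
    by (intro multiset_eqI) (auto simp: count_mset_set' order_0I)
  then show ?thesis
    using size by simp
qed

text \<open>Multiplication by a nonzero \<open>x\<close> permutes the nonzero elements, whose
  product is then cancelled. The extra factor \<open>x\<close> raises the exponent from
  \<open>CARD('a) - 1\<close> to \<open>CARD('a)\<close>.\<close>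

lemma finite_field_power_card:
  fixes x :: "'a::{field,finite}"
  shows "x ^ CARD('a) = x"
proof (cases "x = 0")
  case False
  have "x * (\<Prod>y\<in>UNIV-{0}. x * y) = x * x ^ (CARD('a) - 1) * \<Prod>(UNIV-{0})"
    by (simp add: prod.distrib mult_ac)
  also have "x * x ^ (CARD('a) - 1) = x ^ CARD('a)"
    by (subst power_Suc [symmetric]) (simp add: Suc_leI)
  also have "(\<Prod>y\<in>UNIV-{0}. x * y) = (\<Prod>y\<in>UNIV-{0}. y)"
    by (rule prod.reindex_bij_witness[of _ "\<lambda>y. y / x" "\<lambda>y. x * y"]) (use False in auto)
  finally show ?thesis
    by simp
qed simp

lemma card_finite_field_ge_2: "2 \<le> CARD('a::{field,finite})"
proof -
  have "card {0::'a, 1} \<le> CARD('a)"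
    by (rule card_mono) auto
  then show ?thesis by simp
qed

text \<open>The polynomial $(X+1)^q - X^q - 1$ has degree below $q$ and vanishes on all of the field.\<close>
lemma of_nat_choose_card_eq_0:
  assumes "0 < i" "i < CARD('a::{field,finite})"
  shows "of_nat (CARD('a) choose i) = (0::'a)"
proof -
  define q where "q = CARD('a)"
  define p :: "'a poly" where "p = (\<Sum>j\<in>{0<..<q}. monom (of_nat (q choose j)) j)"
  have q: "2 \<le> q"
    using card_finite_field_ge_2 by (simp add: q_def)
  have "poly p x = 0" for x
  proof -
    have "(x + 1) ^ q = (\<Sum>j\<le>q. of_nat (q choose j) * x ^ j)"
      by (simp add: binomial_ring)
    also have "{..q} = insert 0 (insert q {0<..<q})"
      using q by auto
    also have "(\<Sum>j\<in>\<dots>. of_nat (q choose j) * x ^ j) = 1 + x ^ q + poly p x"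
      using q by (simp add: p_def poly_sum poly_monom)
    finally show ?thesis
      using finite_field_power_card[where 'a = 'a] by (simp add: q_def)
  qed
  then have "{x. poly p x = 0} = UNIV"
    by auto
  moreover have "degree p \<le> q - 1"
    unfolding p_def by (rule degree_sum_le) (auto intro: order.trans[OF degree_monom_le])
  ultimately have "p = 0"
    using card_poly_roots_bound[of p] q by (fastforce simp: q_def)
  then have "coeff p i = 0" by simp
  then show ?thesis
    using assms by (simp add: p_def coeff_sum q_def)
qed

text \<open>The inner binomial coefficients vanish in \<open>'a\<close>, and \<open>to_ac\<close>
  carries this to the closure. Additivity is thus obtained without writing the order as a power of
  the characteristic.\<close>

lemma alg_closure_power_card_add:
  fixes x y :: "'a::{field,finite} alg_closure"
  shows "(x + y) ^ CARD('a) = x ^ CARD('a) + y ^ CARD('a)"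
proof -
  define q where "q = CARD('a)"
  have q: "2 \<le> q"
    using card_finite_field_ge_2 by (simp add: q_def)
  have "(x + y) ^ q = (\<Sum>j\<le>q. of_nat (q choose j) * x ^ j * y ^ (q - j))"
    by (simp add: binomial_ring)
  also have "\<dots> = (\<Sum>j\<in>{0, q}. of_nat (q choose j) * x ^ j * y ^ (q - j))"
  proof (rule sum.mono_neutral_right)
    show "\<forall>j\<in>{..q} - {0, q}. of_nat (q choose j) * x ^ j * y ^ (q - j) = 0"
    proof
      fix j assume "j \<in> {..q} - {0, q}"
      then have "of_nat (q choose j) = (0::'a)"
        unfolding q_def by (intro of_nat_choose_card_eq_0) auto
      then have "to_ac (of_nat (q choose j) :: 'a) = 0"
        by simp
      then have "of_nat (q choose j) = (0::'a alg_closure)"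
        by (simp del: of_nat_eq_0_iff_char_dvd)
      then show "of_nat (q choose j) * x ^ j * y ^ (q - j) = 0"
        by simp
    qed
  qed auto
  also have "\<dots> = x ^ q + y ^ q"
    using q by simp
  finally show ?thesis by (simp add: q_def)
qed

lemma alg_closure_of_nat_card: "of_nat CARD('a) = (0::'a::{field,finite} alg_closure)"
proof -
  have "of_nat (CARD('a) choose 1) = (0::'a)"
    using card_finite_field_ge_2[where 'a = 'a] by (intro of_nat_choose_card_eq_0) auto
  then have "to_ac (of_nat CARD('a) :: 'a) = 0"
    by simp
  then show ?thesis
    by (simp del: of_nat_eq_0_iff_char_dvd)
qed

text \<open>Collects what is used of the algebraic closure of the field with \<open>q\<close>
  elements, so that all fields of the tower are subsets of one type. By \<open>a_conj\<close>,
  \<open>a\<close> has relative trace 0 from \<open>F (2 * m)\<close> to \<open>F m\<close>.\<close>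

locale frobenius =
  fixes q :: nat and a :: "'c::alg_closed_field" and m :: nat
  assumes q_ge_2: "2 \<le> q" and m_pos: "1 \<le> m"
    and power_q_add: "\<And>x y :: 'c. (x + y) ^ q = x ^ q + y ^ q"
    and of_nat_q: "of_nat q = (0::'c)"
    and a_nonzero: "a \<noteq> 0"
    and a_conj: "a ^ (q ^ m) = - a"
begin

text \<open>The fixed field of the \<open>k\<close>-th iterate of the \<open>q\<close>-power map:
  for \<open>1 \<le> k\<close> the field of order \<open>q ^ k\<close>.\<close>

definition F :: "nat \<Rightarrow> 'c set" where
  "F k = {x. x ^ (q ^ k) = x}"

text \<open>On \<open>F k\<close> this is the field trace to \<open>F 1\<close>; the formula is an
  additive polynomial on all of \<open>'c\<close>.\<close>

definition trace :: "nat \<Rightarrow> 'c \<Rightarrow> 'c" where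
  "trace k x = (\<Sum>i<k. x ^ (q ^ i))"

lemma frob_add: "(x + y :: 'c) ^ (q ^ k) = x ^ (q ^ k) + y ^ (q ^ k)"
  by (induction k arbitrary: x y) (simp_all add: power_q_add power_mult)

text \<open>Additivity settles the sign for both parities of \<open>q\<close> at once.\<close>

lemma frob_uminus: "(- x :: 'c) ^ (q ^ k) = - (x ^ (q ^ k))"
proof -
  have "x ^ (q ^ k) + (- x) ^ (q ^ k) = 0"
    using q_ge_2 by (simp flip: frob_add)
  then show ?thesis
    by (simp add: eq_neg_iff_add_eq_0 add.commute)
qed

lemma frob_diff: "(x - y :: 'c) ^ (q ^ k) = x ^ (q ^ k) - y ^ (q ^ k)"
  using frob_add[of x "- y" k] by (simp add: frob_uminus)

lemma frob_sum: "(\<Sum>i\<in>A. f i :: 'c) ^ (q ^ k) = (\<Sum>i\<in>A. f i ^ (q ^ k))"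
  using q_ge_2 by (induction A rule: infinite_finite_induct) (simp_all add: frob_add)

lemma F_0 [simp]: "0 \<in> F k" and F_1 [simp]: "1 \<in> F k"
  using q_ge_2 by (simp_all add: F_def)

lemma F_add: "x \<in> F k \<Longrightarrow> y \<in> F k \<Longrightarrow> x + y \<in> F k"
  and F_diff: "x \<in> F k \<Longrightarrow> y \<in> F k \<Longrightarrow> x - y \<in> F k"
  and F_uminus: "x \<in> F k \<Longrightarrow> - x \<in> F k"
  and F_mult: "x \<in> F k \<Longrightarrow> y \<in> F k \<Longrightarrow> x * y \<in> F k"
  and F_divide: "x \<in> F k \<Longrightarrow> y \<in> F k \<Longrightarrow> x / y \<in> F k"
  by (simp_all add: F_def frob_add frob_diff frob_uminus power_mult_distrib power_divide)

lemmas F_closed = F_add F_diff F_uminus F_mult F_divide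

lemma F_mono:
  assumes "j dvd k"
  shows "F j \<subseteq> F k"
proof -
  have "x ^ (q ^ (j * i)) = x" if "x \<in> F j" for x i
    using that by (induction i) (simp_all add: F_def power_mult power_add)
  then show ?thesis
    using assms by (auto simp: F_def elim!: dvdE)
qed

text \<open>\<open>F k\<close> is the root set of X^(q^k) - X, which is separable: its derivative is
  the constant -1 because \<open>q\<close> is 0 in \<open>'c\<close>.\<close>

lemma card_F:
  assumes "1 \<le> k"
  shows "card (F k) = q ^ k" and "finite (F k)"
proof -
  define p :: "'c poly" where "p = monom 1 (q ^ k) - monom 1 1"
  have gt: "1 < q ^ k"
    using assms q_ge_2 by (intro one_less_power) auto
  have deg: "degree p = q ^ k"
  proof -
    have "degree (monom (1::'c) 1) < degree (monom (1::'c) (q ^ k))"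
      using gt by (simp add: degree_monom_eq)
    then show ?thesis
      unfolding p_def diff_conv_add_uminus
      by (subst degree_add_eq_left) (simp_all add: degree_monom_eq)
  qed
  have "p \<noteq> 0"
    using deg gt by (metis degree_0 not_one_less_zero)
  have F_eq: "F k = {x. poly p x = 0}"
    by (auto simp: F_def p_def poly_monom)
  have "of_nat (q ^ k) = (0::'c)"
    using assms of_nat_q by (cases k) simp_all
  then have "pderiv p = monom (-1) 0"
    by (simp add: p_def pderiv_diff pderiv_monom monom_0 one_pCons del: of_nat_power)
  then have "poly (pderiv p) x \<noteq> 0" for x
    by (simp add: poly_monom)
  then show "card (F k) = q ^ k"
    using card_roots_of_separable[OF \<open>p \<noteq> 0\<close>] deg by (simp add: F_eq)
  show "finite (F k)"
    unfolding F_eq by (rule poly_roots_finite) fact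
qed

section \<open>Traces and the nondegenerate trace pairing\<close>

lemma trace_0 [simp]: "trace k 0 = 0"
  using q_ge_2 by (auto simp: trace_def power_0_left)

lemma trace_add: "trace k (x + y) = trace k x + trace k y"
  by (simp add: trace_def frob_add sum.distrib)

lemma trace_uminus: "trace k (- x) = - trace k x"
  by (simp add: trace_def frob_uminus sum_negf)

lemma trace_scale:
  assumes "c \<in> F 1"
  shows "trace k (c * x) = c * trace k x"
proof -
  have "c ^ (q ^ i) = c" for i
    using assms F_mono[of 1 i] by (auto simp: F_def)
  then show ?thesis
    by (simp add: trace_def power_mult_distrib sum_distrib_left)
qed

text \<open>The \<open>q\<close>-power map shifts the summands cyclically, since the last one
  returns to \<open>x\<close>.\<close>

lemma trace_in_F:
  assumes "x \<in> F k"
  shows "trace k x \<in> F 1"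
proof (cases k)
  case (Suc j)
  have "trace k x ^ (q ^ 1) = (\<Sum>i<k. x ^ (q ^ Suc i))"
    unfolding trace_def frob_sum by (simp flip: power_mult add: mult.commute)
  also have "\<dots> = (\<Sum>i<j. x ^ (q ^ Suc i)) + x"
    using assms Suc by (simp add: F_def)
  also have "\<dots> = trace k x"
    unfolding trace_def Suc sum.lessThan_Suc_shift by simp
  finally show ?thesis
    by (simp add: F_def)
qed (simp add: trace_def)

text \<open>The trace is a polynomial of degree at most \<open>q ^ (k - 1)\<close>, too small to
  vanish on all \<open>q ^ k\<close> elements of \<open>F k\<close>.\<close>

lemma trace_nonzero:
  assumes "1 \<le> k"
  obtains x where "x \<in> F k" "trace k x \<noteq> 0"
proof -
  define p :: "'c poly" where "p = (\<Sum>i<k. monom 1 (q ^ i))"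
  have poly: "poly p x = trace k x" for x
    by (simp add: p_def trace_def poly_sum poly_monom)
  \<comment> \<open>Only the summand \<open>i = 0\<close> contributes to the coefficient of X, so
    \<open>p\<close> is not the zero polynomial.\<close>
  have "coeff p 1 = (\<Sum>i<k. if i = 0 then 1 else 0)"
    unfolding p_def coeff_sum using q_ge_2 by (intro sum.cong) auto
  then have "p \<noteq> 0"
    using assms by auto
  have "degree p \<le> q ^ (k - 1)"
    unfolding p_def using q_ge_2
    by (intro degree_sum_le) (auto intro!: order.trans[OF degree_monom_le] power_increasing)
  also have "\<dots> < q ^ k"
    using q_ge_2 assms by (intro power_strict_increasing) auto
  finally have "card {x. poly p x = 0} < card (F k)"
    using card_poly_roots_bound[OF \<open>p \<noteq> 0\<close>] card_F[OF assms] by simp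
  then have "\<not> F k \<subseteq> {x. poly p x = 0}"
    using card_mono[OF poly_roots_finite[OF \<open>p \<noteq> 0\<close>]] by (metis not_le)
  then show ?thesis
    using that by (auto simp: poly)
qed

text \<open>For nonzero \<open>b\<close> the products \<open>b * c\<close> run through all of
  \<open>F k\<close>, including an element of nonzero trace.\<close>

lemma trace_nondegenerate:
  assumes "1 \<le> k" "b \<in> F k" and zero: "\<And>c. c \<in> F k \<Longrightarrow> trace k (b * c) = 0"
  shows "b = 0"
proof (rule ccontr)
  assume "b \<noteq> 0"
  obtain x where "x \<in> F k" "trace k x \<noteq> 0"
    using trace_nonzero[OF assms(1)] .
  then show False
    using zero[of "x / b"] \<open>b \<noteq> 0\<close> assms(2) by (simp add: F_divide)
qed

section \<open>A partial spread of the plane over K\<close>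

abbreviation K :: "'c set" where "K \<equiv> F (2 * m)"
abbreviation L :: "'c set" where "L \<equiv> F m"
abbreviation conj :: "'c \<Rightarrow> 'c" where "conj x \<equiv> x ^ (q ^ m)"

lemma L_subset_K: "L \<subseteq> K"
  by (rule F_mono) simp

lemma conj_conj: "x \<in> K \<Longrightarrow> conj (conj x) = x"
  by (simp add: F_def flip: power_mult power_add mult_2)

text \<open>Transitivity of the trace through \<open>L\<close>: the exponents from \<open>m\<close>
  on give the summands of the conjugate.\<close>

lemma trace_tower: "trace (2 * m) x = trace m (x + conj x)"
proof -
  have "trace (2 * m) x = (\<Sum>i<m. x ^ (q ^ i)) + (\<Sum>i<m. x ^ (q ^ (m + i)))"
    unfolding trace_def mult_2 lessThan_atLeast0 sum.atLeastLessThan_concat[of 0 m "m + m", symmetric, OF le0 le_add1]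
    using sum.shift_bounds_nat_ivl[of "\<lambda>i. x ^ (q ^ i)" 0 m m] by (simp add: add.commute)
  then show ?thesis
    by (simp add: trace_def frob_add sum.distrib power_mult power_add)
qed

lemma a_in_K: "a \<in> K"
proof -
  have "conj (conj a) = a"
    by (simp add: a_conj frob_uminus)
  then show ?thesis
    by (simp add: F_def mult_2 power_add power_mult)
qed

section \<open>The trace form on the plane over \<open>K\<close>\<close>

definition cdet :: "'c \<times> 'c \<Rightarrow> 'c \<times> 'c \<Rightarrow> 'c" where
  "cdet v w = fst v * snd w - snd v * fst w"

text \<open>Values stay in \<open>'c\<close>; on \<open>K \<times> K\<close> they lie in
  \<open>F 1\<close> and can be pulled back to the scalar type.\<close>

definition tform :: "'c \<times> 'c \<Rightarrow> 'c \<times> 'c \<Rightarrow> 'c" where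
  "tform v w = trace (2 * m) (a * cdet v w)"

lemma tform_add_left: "tform (v + v') w = tform v w + tform v' w"
  by (simp add: tform_def cdet_def algebra_simps flip: trace_add)

lemma tform_scale_left:
  "c \<in> F 1 \<Longrightarrow> tform (c * fst v, c * snd v) w = c * tform v w"
  by (simp add: tform_def cdet_def algebra_simps flip: trace_scale)

lemma tform_alternating: "tform v v = 0"
  by (simp add: tform_def cdet_def)

lemma tform_in_F: "v \<in> K \<times> K \<Longrightarrow> w \<in> K \<times> K \<Longrightarrow> tform v w \<in> F 1"
  unfolding tform_def cdet_def
  by (intro trace_in_F F_closed a_in_K) auto

text \<open>Testing against the two coordinate axes reduces each coordinate of \<open>v\<close> to
  the trace pairing on \<open>K\<close>.\<close>

lemma tform_nondegenerate:
  assumes v: "v \<in> K \<times> K" and zero: "\<And>w. w \<in> K \<times> K \<Longrightarrow> tform v w = 0"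
  shows "v = 0"
proof -
  have "a * fst v = 0"
  proof (rule trace_nondegenerate)
    fix c assume "c \<in> K"
    then show "trace (2 * m) (a * fst v * c) = 0"
      using zero[of "(0, c)"] by (simp add: tform_def cdet_def mult.assoc)
  qed (use m_pos v a_in_K in \<open>auto intro!: F_mult\<close>)
  moreover have "- (a * snd v) = 0"
  proof (rule trace_nondegenerate)
    fix c assume "c \<in> K"
    then show "trace (2 * m) (- (a * snd v) * c) = 0"
      using zero[of "(c, 0)"] by (simp add: tform_def cdet_def mult.assoc)
  qed (use m_pos v a_in_K in \<open>auto intro!: F_mult F_uminus\<close>)
  ultimately show ?thesis
    using a_nonzero by (simp add: prod_eq_iff)
qed

text \<open>
  The first kind of member is a point of the projective line over \<open>K\<close> that is not a point of the
  subline over \<open>L\<close>; the second kind is a regular subplane meeting the points of that subline.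
\<close>

definition point :: "'c \<Rightarrow> ('c \<times> 'c) set" where
  "point s = (\<lambda>x. (x, s * x)) ` K"

definition subplane :: "'c \<Rightarrow> ('c \<times> 'c) set" where
  "subplane c = (\<lambda>(x, y). (c * x, c * y)) ` (L \<times> L)"

definition spread :: "('c \<times> 'c) set set" where
  "spread = point ` (K - L) \<union> {subplane 1, subplane a}"

text \<open>A totally isotropic \<open>F 1\<close>-subspace of half the dimension. Dimension
  \<open>2 * m\<close> over \<open>F 1\<close> is expressed by the size
  \<open>q ^ (2 * m)\<close>.\<close>

definition tispace :: "('c \<times> 'c) set \<Rightarrow> bool" where
  "tispace U \<longleftrightarrow> U \<subseteq> K \<times> K \<and> 0 \<in> U \<and> (\<forall>v\<in>U. \<forall>w\<in>U. v + w \<in> U) \<and>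
     (\<forall>c\<in>F 1. \<forall>v\<in>U. (c * fst v, c * snd v) \<in> U) \<and>
     card U = q ^ (2 * m) \<and> (\<forall>v\<in>U. \<forall>w\<in>U. tform v w = 0)"

lemma card_K: "card K = q ^ (2 * m)" "finite K" and card_L: "card L = q ^ m" "finite L"
  using card_F[of "2 * m"] card_F[of m] m_pos by simp_all

lemma card_point: "card (point s) = q ^ (2 * m)"
  unfolding point_def by (subst card_image) (auto simp: inj_on_def card_K)

lemma finite_subplane: "finite (subplane c)"
  unfolding subplane_def by (simp add: card_L)

lemma card_subplane: "c \<noteq> 0 \<Longrightarrow> card (subplane c) = q ^ (2 * m)"
  unfolding subplane_def
  by (subst card_image)
     (auto simp: inj_on_def card_cartesian_product card_L mult_2 power_add)

lemma tispace_point: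
  assumes "s \<in> K"
  shows "tispace (point s)"
  unfolding tispace_def
proof (intro conjI)
  show "point s \<subseteq> K \<times> K"
    using assms by (auto simp: point_def F_mult)
  show "0 \<in> point s"
    by (force simp: point_def zero_prod_def)
  show "\<forall>v\<in>point s. \<forall>w\<in>point s. v + w \<in> point s"
    by (auto simp: point_def F_add distrib_left intro!: image_eqI)
  have "F 1 \<subseteq> K"
    by (rule F_mono) simp
  then show "\<forall>c\<in>F 1. \<forall>v\<in>point s. (c * fst v, c * snd v) \<in> point s"
    by (auto simp: point_def intro!: image_eqI F_mult)
  show "\<forall>v\<in>point s. \<forall>w\<in>point s. tform v w = 0"
    by (auto simp: point_def tform_def cdet_def)
qed (rule card_point)

text \<open>On \<open>subplane c\<close> the argument of the trace is \<open>a * c\<^sup>2\<close>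
  times an element of \<open>L\<close>. It is negated by \<open>conj\<close>, so already its
  relative trace to \<open>L\<close> is 0.\<close>

lemma tform_subplane:
  assumes c: "conj (a * c\<^sup>2) = - (a * c\<^sup>2)" and v: "v \<in> subplane c" and w: "w \<in> subplane c"
  shows "tform v w = 0"
proof -
  obtain x y where xy: "x \<in> L" "y \<in> L" "v = (c * x, c * y)"
    using v by (auto simp: subplane_def)
  obtain z t where zt: "z \<in> L" "t \<in> L" "w = (c * z, c * t)"
    using w by (auto simp: subplane_def)
  define d where "d = x * t - y * z"
  have d: "conj d = d"
    using xy zt F_diff[OF F_mult F_mult] by (simp add: d_def F_def)
  have "a * cdet v w = a * c\<^sup>2 * d"
    by (simp add: cdet_def xy zt d_def power2_eq_square algebra_simps)
  then have "tform v w = trace m (a * c\<^sup>2 * d + conj (a * c\<^sup>2 * d))"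
    by (simp only: tform_def trace_tower)
  also have "conj (a * c\<^sup>2 * d) = - (a * c\<^sup>2 * d)"
    using c d by (simp add: power_mult_distrib)
  finally show ?thesis by simp
qed

lemma tispace_subplane:
  assumes c: "c \<in> K" "c \<noteq> 0" and conj_c: "conj (a * c\<^sup>2) = - (a * c\<^sup>2)"
  shows "tispace (subplane c)"
  unfolding tispace_def
proof (intro conjI)
  show "subplane c \<subseteq> K \<times> K"
    using c L_subset_K by (auto simp: subplane_def intro!: F_mult)
  show "0 \<in> subplane c"
    by (force simp: subplane_def zero_prod_def)
  show "\<forall>v\<in>subplane c. \<forall>w\<in>subplane c. v + w \<in> subplane c"
    by (force simp: subplane_def F_add distrib_left[symmetric])
  have "F 1 \<subseteq> L"
    by (rule F_mono) simp
  then show "\<forall>b\<in>F 1. \<forall>v\<in>subplane c. (b * fst v, b * snd v) \<in> subplane c"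
    by (force simp: subplane_def F_mult mult.left_commute[of _ c])
  show "\<forall>v\<in>subplane c. \<forall>w\<in>subplane c. tform v w = 0"
    using tform_subplane[OF conj_c] by blast
qed (rule card_subplane[OF c(2)])

lemma tispace_spread: "U \<in> spread \<Longrightarrow> tispace U"
proof -
  have "tispace (subplane 1)"
    by (rule tispace_subplane) (simp_all add: a_conj)
  \<comment> \<open>Here the condition concerns the cube of \<open>a\<close>, which
    \<open>conj\<close> negates like every odd power of \<open>a\<close>.\<close>
  moreover have "tispace (subplane a)"
    by (rule tispace_subplane)
       (simp_all add: a_in_K a_nonzero power_mult_distrib a_conj power2_eq_square)
  ultimately show "U \<in> spread \<Longrightarrow> tispace U"
    by (auto simp: spread_def tispace_point)
qed

section \<open>Intersections of members\<close>

lemma subplane_subset: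
  assumes "c / d \<in> L" "d \<noteq> 0"
  shows "subplane c \<subseteq> subplane d"
proof
  fix v assume "v \<in> subplane c"
  then obtain x y where "x \<in> L" "y \<in> L" "v = (c * x, c * y)"
    by (auto simp: subplane_def)
  then have "v = (\<lambda>(x, y). (d * x, d * y)) (c / d * x, c / d * y)"
    and "(c / d * x, c / d * y) \<in> L \<times> L"
    using assms F_mult[OF assms(1), of x] F_mult[OF assms(1), of y] by auto
  then show "v \<in> subplane d"
    unfolding subplane_def by blast
qed

text \<open>A factor from \<open>L\<close> can be moved from the multiplier into the coordinates, in
  both directions.\<close>

lemma subplane_eq:
  assumes "c / d \<in> L" "c \<noteq> 0" "d \<noteq> 0"
  shows "subplane c = subplane d"
proof (rule equalityI)
  have "d / c \<in> L"
    using F_divide[OF F_1 assms(1)] by simp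
  then show "subplane d \<subseteq> subplane c"
    using assms by (intro subplane_subset)
qed (use assms subplane_subset in auto)

text \<open>A nonzero coordinate of a common vector exhibits \<open>c / d\<close> as a quotient of
  elements of \<open>L\<close>, which makes the subplanes equal.\<close>

lemma subplane_Int_subplane:
  assumes "subplane c \<noteq> subplane d" "c \<noteq> 0" "d \<noteq> 0"
  shows "subplane c \<inter> subplane d \<subseteq> {0}"
proof
  fix v assume "v \<in> subplane c \<inter> subplane d"
  then obtain x y z t where v: "x \<in> L" "y \<in> L" "z \<in> L" "t \<in> L" "v = (c * x, c * y)" "v = (d * z, d * t)"
    by (auto simp: subplane_def)
  have "c / d \<notin> L"
    using assms subplane_eq by blast
  moreover have "c / d \<in> L" if "x \<noteq> 0"
  proof -
    have "c / d = z / x"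
      using v assms that by (simp add: field_simps)
    then show ?thesis using v F_divide by simp
  qed
  moreover have "c / d \<in> L" if "y \<noteq> 0"
  proof -
    have "c / d = t / y"
      using v assms that by (simp add: field_simps)
    then show ?thesis using v F_divide by simp
  qed
  ultimately show "v \<in> {0}"
    using v by (auto simp: zero_prod_def)
qed

lemma point_Int_point:
  assumes "s \<noteq> t"
  shows "point s \<inter> point t \<subseteq> {0}"
  using assms by (auto simp: point_def zero_prod_def)

text \<open>A nonzero vector of \<open>point s\<close> has slope \<open>s\<close>, whereas a
  nonvertical vector of a subplane has slope in \<open>L\<close>.\<close>

lemma point_Int_subplane:
  assumes "s \<notin> L"
  shows "point s \<inter> subplane c \<subseteq> {0}"
proof
  fix v assume "v \<in> point s \<inter> subplane c"
  then obtain x y z where v: "x \<in> L" "y \<in> L" "v = (c * x, c * y)" "v = (z, s * z)"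
    by (auto simp: point_def subplane_def)
  have "z = 0"
  proof (rule ccontr)
    assume "z \<noteq> 0"
    then have "s = y / x"
      using v by (auto simp: field_simps)
    then show False
      using v assms F_divide by blast
  qed
  then show "v \<in> {0}"
    using v by (simp add: zero_prod_def)
qed

lemma spread_disjoint:
  assumes "U \<in> spread" "W \<in> spread" "U \<noteq> W"
  shows "U \<inter> W = {0}"
proof -
  have kinds: "(\<exists>s. s \<notin> L \<and> V = point s) \<or> (\<exists>c. c \<noteq> 0 \<and> V = subplane c)" if "V \<in> spread" for V
    using that a_nonzero one_neq_zero[where 'a = 'c] unfolding spread_def by blast
  have "U \<inter> W \<subseteq> {0}"
    using kinds[OF assms(1)] kinds[OF assms(2)] assms(3)
      point_Int_point point_Int_subplane subplane_Int_subplane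
    by (metis inf_commute)
  moreover have "0 \<in> U" "0 \<in> W"
    using assms tispace_spread by (auto simp: tispace_def)
  ultimately show ?thesis by blast
qed

section \<open>Counting vectors and members\<close>

lemma one_less_card_K: "1 < q ^ (2 * m)"
  using q_ge_2 m_pos by (intro one_less_power) auto

lemma tispace_nontrivial:
  assumes "tispace U"
  obtains v where "v \<in> U" "v \<noteq> 0"
proof -
  have "\<not> U \<subseteq> {0}"
    using assms one_less_card_K card_mono[of "{0}" U] by (auto simp: tispace_def)
  then show ?thesis using that by blast
qed

text \<open>The two subplanes agree when \<open>a \<in> L\<close>, that is when
  \<open>- a = a\<close>; as \<open>a \<noteq> 0\<close>, this is characteristic 2.\<close>

lemma card_subplanes: "card {subplane 1, subplane a} = gcd 2 (q - 1)"
proof (cases "even q")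
  case True
  \<comment> \<open>The \<open>q\<close>-power of -1 is -1 by additivity but 1 by parity, so the
    characteristic is 2.\<close>
  have "(- 1 :: 'c) ^ (q ^ 1) = - 1"
    by (simp only: frob_uminus) simp
  then have "(1 :: 'c) = - 1"
    using True by simp
  then have "- a = a"
    by (metis mult_minus1 mult_1)
  then have "1 / a \<in> L"
    using F_divide[OF F_1] a_conj by (simp add: F_def)
  then have "subplane 1 = subplane a"
    using a_nonzero by (intro subplane_eq) auto
  moreover have "odd (q - 1)"
    using True q_ge_2 by simp
  ultimately show ?thesis
    by (simp add: coprime_iff_gcd_eq_1[symmetric] coprime_left_2_iff_odd)
next
  case False
  then obtain k where k: "q = 2 * k + 1"
    by (elim oddE)
  have "(2 :: 'c) \<noteq> 0"
  proof
    assume "(2 :: 'c) = 0"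
    then have "of_nat q = (1 :: 'c)"
      by (simp add: k)
    then show False
      using of_nat_q by simp
  qed
  have "a \<notin> L"
  proof
    assume "a \<in> L"
    then have "2 * a = 0"
      using a_conj by (simp add: F_def)
    then show False
      using \<open>(2 :: 'c) \<noteq> 0\<close> a_nonzero by simp
  qed
  have "(a, 0) \<in> subplane a"
    by (force simp: subplane_def)
  moreover have "(a, 0) \<notin> subplane 1"
    using \<open>a \<notin> L\<close> by (auto simp: subplane_def)
  ultimately have "subplane 1 \<noteq> subplane a"
    by metis
  moreover have "gcd 2 (q - 1) = 2"
    by (simp add: k)
  ultimately show ?thesis by simp
qed

lemma card_spread: "card spread = q ^ (2 * m) - q ^ m + gcd 2 (q - 1)"
proof -
  have "inj_on point (K - L)"
  proof (rule inj_onI)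
    fix s t assume st: "s \<in> K - L" "t \<in> K - L" "point s = point t"
    have "(1, s) \<in> point s"
      by (force simp: point_def)
    then show "s = t"
      using st by (auto simp: point_def)
  qed
  then have "card (point ` (K - L)) = q ^ (2 * m) - q ^ m"
    using L_subset_K by (simp add: card_image card_Diff_subset card_K card_L)
  moreover have "point ` (K - L) \<inter> {subplane 1, subplane a} = {}"
  proof -
    have "point s \<noteq> subplane c" if s: "s \<in> K - L" for s c
    proof
      assume "point s = subplane c"
      then have "point s \<subseteq> {0}"
        using point_Int_subplane[of s c] s by simp
      moreover have "(1, s) \<in> point s"
        by (force simp: point_def)
      ultimately show False
        by (auto simp: zero_prod_def)
    qed
    then show ?thesis by blast
  qed
  ultimately show ?thesis
    unfolding spread_def using card_K(2) card_subplanes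
    by (subst card_Un_disjoint) simp_all
qed

text \<open>
  On the union of the points of the subline the polynomial \<open>x conj y - conj x y\<close> vanishes;
  polarizing it at \<open>v + w\<close> compares the multipliers of \<open>v\<close> and \<open>w\<close>.
\<close>
lemma multiplier_quotient_in_L:
  assumes "x \<in> L" "y \<in> L" "z \<in> L" "t \<in> L" "p \<in> L" "r \<in> L"
    and sum: "(k * x + l * z, k * y + l * t) = (j * p, j * r)"
    and indep: "x * t \<noteq> y * z"
  shows "k / l \<in> L"
proof -
  have fixed: "conj x = x" "conj y = y" "conj z = z" "conj t = t" "conj p = p" "conj r = r"
    using assms by (simp_all add: F_def)
  have "j * p * conj (j * r) = conj (j * p) * (j * r)"
    by (simp add: power_mult_distrib fixed)
  then have "(k * x + l * z) * conj (k * y + l * t) = conj (k * x + l * z) * (k * y + l * t)"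
    using sum by simp
  then have "(k * x + l * z) * (conj k * y + conj l * t) = (conj k * x + conj l * z) * (k * y + l * t)"
    by (simp add: frob_add power_mult_distrib fixed)
  \<comment> \<open>With \<open>k'\<close> and \<open>l'\<close> standing for the conjugates of
    \<open>k\<close> and \<open>l\<close>, the polarized expression factors into two
    determinants.\<close>
  moreover have "(k * x + l * z) * (k' * y + l' * t) - (k' * x + l' * z) * (k * y + l * t)
      = (k * l' - k' * l) * (x * t - y * z)" for k' l'
    by (simp add: algebra_simps)
  ultimately have "(k * conj l - conj k * l) * (x * t - y * z) = 0"
    by (metis right_minus_eq)
  then have "k * conj l = conj k * l"
    using indep by simp
  \<comment> \<open>For \<open>l = 0\<close> the quotient is 0 by convention, which lies in
    \<open>L\<close>.\<close>
  then show ?thesis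
    using q_ge_2 by (cases "l = 0") (auto simp: F_def power_divide field_simps)
qed

section \<open>Maximality\<close>

lemma spread_maximal:
  assumes U: "tispace U" and disjoint: "\<And>W. W \<in> spread \<Longrightarrow> U \<inter> W = {0}"
  shows "U \<in> spread"
proof -
  have U_K: "U \<subseteq> K \<times> K" and U_add: "\<And>v w. v \<in> U \<Longrightarrow> w \<in> U \<Longrightarrow> v + w \<in> U"
    and card_U: "card U = q ^ (2 * m)" and U_iso: "\<And>v w. v \<in> U \<Longrightarrow> w \<in> U \<Longrightarrow> tform v w = 0"
    using U by (auto simp: tispace_def)
  \<comment> \<open>Avoiding every \<open>point s\<close> with \<open>s\<close> outside
    \<open>L\<close> forces each vector to be a \<open>K\<close>-multiple of a vector with
    coordinates in \<open>L\<close>.\<close>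
  have rep: "\<exists>k x y. k \<in> K \<and> k \<noteq> 0 \<and> x \<in> L \<and> y \<in> L \<and> v = (k * x, k * y)" if v: "v \<in> U" for v
  proof -
    obtain x y where xy: "v = (x, y)" "x \<in> K" "y \<in> K"
      using v U_K by auto
    show ?thesis
    proof (cases "x = 0")
      case True
      \<comment> \<open>A vertical vector has no slope, but its direction (0, 1) is defined over
        \<open>L\<close>. The zero vector gets multiplier 1.\<close>
      have "y = 0 \<or> y \<noteq> 0 \<and> y \<in> K \<and> v = (y * 0, y * 1)" "y = 0 \<longrightarrow> v = (1 * 0, 1 * 0)"
        using xy True by auto
      then show ?thesis
        using F_0 F_1 one_neq_zero by metis
    next
      case False
      have "v = (x, y / x * x)"
        using xy False by simp
      then have "v \<in> point (y / x)"
        using xy by (auto simp: point_def)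
      moreover have "v \<noteq> 0"
        using False xy by (simp add: zero_prod_def)
      ultimately have "point (y / x) \<notin> spread"
        using disjoint v by blast
      then have "y / x \<in> L"
        using F_divide[OF xy(3,2)] by (auto simp: spread_def)
      moreover have "v = (x * 1, x * (y / x))"
        using False xy by simp
      ultimately show ?thesis
        using False xy(2) F_1 by blast
    qed
  qed
  have quot: "k / l \<in> L"
    if "(k * x, k * y) \<in> U" "(l * z, l * t) \<in> U" "x \<in> L" "y \<in> L" "z \<in> L" "t \<in> L"
      "cdet (k * x, k * y) (l * z, l * t) \<noteq> 0" for k l x y z t
  proof -
    have "(k * x + l * z, k * y + l * t) \<in> U"
      using U_add[OF that(1,2)] by simp
    then obtain j p r where "p \<in> L" "r \<in> L" "(k * x + l * z, k * y + l * t) = (j * p, j * r)"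
      using rep by metis
    moreover have "x * t \<noteq> y * z"
    proof
      assume eq: "x * t = y * z"
      have "cdet (k * x, k * y) (l * z, l * t) = k * l * (x * t - y * z)"
        by (simp add: cdet_def algebra_simps)
      then show False
        using that(7) eq by simp
    qed
    ultimately show ?thesis
      using multiplier_quotient_in_L that by blast
  qed
  \<comment> \<open>Otherwise \<open>U\<close> lies on one line over \<open>K\<close>, fills it by
    counting, and so contains a nonzero vector of \<open>subplane 1\<close>.\<close>
  have "\<exists>v\<in>U. \<exists>w\<in>U. cdet v w \<noteq> 0"
  proof (rule ccontr)
    assume none: "\<not> (\<exists>v\<in>U. \<exists>w\<in>U. cdet v w \<noteq> 0)"
    obtain v where v: "v \<in> U" "v \<noteq> 0"
      using tispace_nontrivial[OF U] .
    obtain k x y where kxy: "k \<noteq> 0" "x \<in> L" "y \<in> L" "v = (k * x, k * y)"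
      using rep[OF v(1)] by blast
    have xy: "x \<noteq> 0 \<or> y \<noteq> 0" "x \<in> K" "y \<in> K"
      using v kxy L_subset_K by (auto simp: zero_prod_def)
    have sub: "U \<subseteq> (\<lambda>c. (c * x, c * y)) ` K"
    proof
      fix w assume w: "w \<in> U"
      obtain z t where zt: "w = (z, t)" "z \<in> K" "t \<in> K"
        using w U_K by auto
      have "cdet v w = 0"
        using none v w by blast
      then have "k * (x * t - y * z) = 0"
        by (simp add: cdet_def kxy(4) zt(1) algebra_simps)
      then have eq: "x * t = y * z"
        using kxy by simp
      show "w \<in> (\<lambda>c. (c * x, c * y)) ` K"
      proof (cases "x = 0")
        case True
        then have "w = (t / y * x, t / y * y)"
          using xy eq zt by simp
        then show ?thesis
          using F_divide zt xy by blast
      next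
        case False
        then have "w = (z / x * x, z / x * y)"
          using eq zt by (simp add: field_simps)
        then show ?thesis
          using F_divide zt xy by blast
      qed
    qed
    have "card ((\<lambda>c. (c * x, c * y)) ` K) \<le> card U"
      using card_image_le[OF card_K(2)] by (simp add: card_U card_K)
    then have "U = (\<lambda>c. (c * x, c * y)) ` K"
      using sub card_K(2) card_mono[OF _ sub] by (intro card_subset_eq) auto
    then have "(x, y) \<in> U"
      by force
    moreover have "(x, y) \<in> subplane 1"
      using kxy by (force simp: subplane_def)
    ultimately have "(x, y) = 0"
      using disjoint[of "subplane 1"] by (auto simp: spread_def)
    then show False
      using xy by (simp add: zero_prod_def)
  qed
  then obtain v w where vw: "v \<in> U" "w \<in> U" "cdet v w \<noteq> 0"
    by blast
  obtain k x y where v: "k \<in> K" "k \<noteq> 0" "x \<in> L" "y \<in> L" "v = (k * x, k * y)"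
    using rep[OF vw(1)] by blast
  obtain l z t where w: "l \<in> K" "l \<noteq> 0" "z \<in> L" "t \<in> L" "w = (l * z, l * t)"
    using rep[OF vw(2)] by blast
  have kl: "k / l \<in> L"
    using quot vw v w by blast
  have "U \<subseteq> subplane k"
  proof
    fix u assume u: "u \<in> U"
    obtain j p r where jpr: "j \<in> K" "j \<noteq> 0" "p \<in> L" "r \<in> L" "u = (j * p, j * r)"
      using rep[OF u] by blast
    \<comment> \<open>A nonzero \<open>u\<close> is independent over \<open>K\<close> of
      \<open>v\<close> or of \<open>w\<close>; in the second case \<open>j\<close> is compared with
      \<open>k\<close> through \<open>l\<close>.\<close>
    have "j / k \<in> L \<or> u = 0"
    proof (cases "cdet u v = 0")
      case False
      then show ?thesis
        using quot jpr v u vw by blast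
    next
      case uv: True
      show ?thesis
      proof (cases "cdet u w = 0")
        case False
        then have "j / l \<in> L"
          using quot jpr w u vw by blast
        then have "(j / l) / (k / l) \<in> L"
          using kl by (rule F_divide)
        then show ?thesis
          using w by simp
      next
        case uw: True
        \<comment> \<open>Cramer's rule expresses \<open>u\<close> by its determinants with
          \<open>v\<close> and \<open>w\<close>, so here \<open>u\<close> is 0.\<close>
        have "fst u * cdet v w = fst v * cdet u w - fst w * cdet u v"
          and "snd u * cdet v w = snd v * cdet u w - snd w * cdet u v"
          by (simp_all add: cdet_def algebra_simps)
        then show ?thesis
          using uv uw vw(3) by (simp add: prod_eq_iff)
      qed
    qed
    moreover have "u \<in> subplane j"
      using jpr by (force simp: subplane_def)
    ultimately show "u \<in> subplane k"
      using subplane_subset[of j k] v by (force simp: subplane_def zero_prod_def)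
  qed
  then have U_eq: "U = subplane k"
    using card_subplane[OF v(2)] card_U finite_subplane by (intro card_subset_eq) auto
  \<comment> \<open>The relative trace of \<open>a * k\<^sup>2\<close> to \<open>L\<close>; isotropy
    of \<open>U\<close> makes it orthogonal to \<open>L\<close> under the trace pairing.\<close>
  define b where "b = a * k\<^sup>2 + conj (a * k\<^sup>2)"
  have ak: "a * k\<^sup>2 \<in> K"
    using a_in_K v by (simp add: power2_eq_square F_mult)
  have "b = 0"
  proof (rule trace_nondegenerate[OF m_pos])
    show "b \<in> L"
      unfolding b_def F_def by (simp add: frob_add conj_conj[OF ak] add.commute)
    fix c assume c: "c \<in> L"
    \<comment> \<open>These two vectors have determinant \<open>k\<^sup>2 * c\<close>.\<close>
    have "(k, 0) \<in> U" "(0, k * c) \<in> U"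
      using c unfolding U_eq subplane_def by force+
    then have "trace (2 * m) (a * (k * (k * c))) = 0"
      using U_iso by (force simp: tform_def cdet_def)
    also have "a * (k * (k * c)) = a * k\<^sup>2 * c"
      by (simp add: power2_eq_square)
    also have "trace (2 * m) \<dots> = trace m (b * c)"
      unfolding trace_tower b_def using c
      by (simp add: power_mult_distrib[of _ c] F_def distrib_right)
    finally show "trace m (b * c) = 0" .
  qed
  then have "a * k\<^sup>2 = a * (conj k)\<^sup>2"
    by (simp add: b_def power_mult_distrib a_conj power_commutes flip: power_mult)
       (simp add: mult.commute)
  then have "k\<^sup>2 = (conj k)\<^sup>2"
    using a_nonzero by simp
  then have "conj k = k \<or> conj k = - k"
    by (metis power2_eq_iff)
  \<comment> \<open>If \<open>conj\<close> negates \<open>k\<close>, it fixes \<open>k / a\<close>,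
    because it negates \<open>a\<close> as well.\<close>
  then have "k / 1 \<in> L \<or> k / a \<in> L"
    by (auto simp: F_def power_divide a_conj)
  then have "U = subplane 1 \<or> U = subplane a"
    using subplane_eq U_eq v(2) a_nonzero by (metis one_neq_zero)
  then show ?thesis
    by (auto simp: spread_def)
qed

end

section \<open>Isometries of symplectic spaces over finite fields\<close>

lemma (in vector_space) card_span_independent:
  assumes "finite B" "independent B"
  shows "card (span B) = CARD('a) ^ card B"
  using assms
proof (induction B rule: finite_induct)
  case (insert b B)
  have indep: "independent B" "b \<notin> span B"
    using insert.prems insert.hyps by (simp_all add: independent_insert)
  \<comment> \<open>The coefficient of \<open>b\<close> and the remainder in \<open>span B\<close>
    are unique, so adjoining \<open>b\<close> multiplies the size by
    \<open>CARD('a)\<close>.\<close>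
  have "span (insert b B) = (\<lambda>(c, v). scale c b + v) ` (UNIV \<times> span B)"
  proof (intro equalityI subsetI)
    fix x assume "x \<in> span (insert b B)"
    then obtain k where "x - scale k b \<in> span B"
      by (auto simp: span_breakdown_eq)
    then show "x \<in> (\<lambda>(c, v). scale c b + v) ` (UNIV \<times> span B)"
      by (intro image_eqI[of _ _ "(k, x - scale k b)"]) auto
  next
    fix x assume "x \<in> (\<lambda>(c, v). scale c b + v) ` (UNIV \<times> span B)"
    then obtain c v where "v \<in> span B" "x = scale c b + v"
      by auto
    then show "x \<in> span (insert b B)"
      by (auto simp: span_breakdown_eq intro!: exI[of _ c])
  qed
  moreover have "inj_on (\<lambda>(c, v). scale c b + v) (UNIV \<times> span B)"
  proof (rule inj_onI, clarify)
    fix c v d w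
    assume vw: "v \<in> span B" "w \<in> span B" and eq: "scale c b + v = scale d b + w"
    then have "scale (c - d) b = w - v"
      by (simp add: scale_left_diff_distrib algebra_simps)
    then have "scale (c - d) b \<in> span B"
      using vw by (simp add: span_diff)
    then have "c - d = 0"
      using indep(2) span_scale[of "scale (c - d) b" B "inverse (c - d)"]
      by (metis left_inverse scale_one scale_scale)
    then show "c = d \<and> v = w"
      using eq by simp
  qed
  ultimately have "card (span (insert b B)) = CARD('a) * card (span B)"
    by (simp add: card_image card_cartesian_product)
  then show ?case
    using insert.IH indep(1) insert.hyps by simp
qed simp

lemma (in vector_space) card_eq_power_dim:
  assumes "subspace U" "finite U"
  shows "card U = CARD('a) ^ dim U"
proof -
  obtain B where B: "B \<subseteq> U" "independent B" "U \<subseteq> span B" "card B = dim U"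
    using basis_exists .
  have "span B = U"
    using B assms(1) by (simp add: span_minimal subset_antisym)
  then show ?thesis
    using card_span_independent[of B] B finite_subset[OF B(1) assms(2)] by simp
qed

text \<open>The form axioms are restricted to a carrier set, so that the locale covers the
  complements in the induction as well as \<open>K \<times> K\<close>.\<close>

locale symplectic_subspace = vector_space scale
  for scale :: "'a::{field,finite} \<Rightarrow> 'b::ab_group_add \<Rightarrow> 'b" +
  fixes W :: "'b set" and f :: "'b \<Rightarrow> 'b \<Rightarrow> 'a"
  assumes subspace_W: "subspace W"
    and finite_W: "finite W"
    and add_left: "\<And>x y z. x \<in> W \<Longrightarrow> y \<in> W \<Longrightarrow> z \<in> W \<Longrightarrow> f (x + y) z = f x z + f y z"
    and add_right: "\<And>x y z. x \<in> W \<Longrightarrow> y \<in> W \<Longrightarrow> z \<in> W \<Longrightarrow> f x (y + z) = f x y + f x z"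
    and scale_left: "\<And>c x z. x \<in> W \<Longrightarrow> z \<in> W \<Longrightarrow> f (scale c x) z = c * f x z"
    and alternating: "\<And>x. x \<in> W \<Longrightarrow> f x x = 0"
    and nondegenerate: "\<And>x. x \<in> W \<Longrightarrow> (\<And>y. y \<in> W \<Longrightarrow> f x y = 0) \<Longrightarrow> x = 0"
begin

lemmas W_closed [simp] =
  subspace_add[OF subspace_W] subspace_diff[OF subspace_W] subspace_scale[OF subspace_W]
  subspace_0[OF subspace_W]

lemma skew:
  assumes "x \<in> W" "y \<in> W"
  shows "f x y = - f y x"
proof -
  have "f x y + f y x = f (x + y) (x + y)"
    using assms alternating[of x] alternating[of y] by (simp add: add_left add_right)
  also have "\<dots> = 0"
    using assms by (intro alternating) simp
  finally show ?thesis
    by (simp add: eq_neg_iff_add_eq_0)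
qed

lemma scale_right: "x \<in> W \<Longrightarrow> y \<in> W \<Longrightarrow> f x (scale c y) = c * f x y"
  using skew[of x "scale c y"] skew[of x y] by (simp add: scale_left)

lemma diff_left: "x \<in> W \<Longrightarrow> y \<in> W \<Longrightarrow> z \<in> W \<Longrightarrow> f (x - y) z = f x z - f y z"
  using add_left[of "x - y" y z] by simp

lemma diff_right: "x \<in> W \<Longrightarrow> y \<in> W \<Longrightarrow> z \<in> W \<Longrightarrow> f x (y - z) = f x y - f x z"
  using add_right[of x "y - z" z] by simp

lemmas expand = add_left add_right diff_left diff_right scale_left scale_right alternating

definition perp :: "'b \<Rightarrow> 'b \<Rightarrow> 'b set" where
  "perp x y = {w \<in> W. f x w = 0 \<and> f y w = 0}"

text \<open>For \<open>f x y = 1\<close>, the projection to \<open>perp x y\<close> along the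
  hyperbolic plane spanned by \<open>x\<close> and \<open>y\<close>.\<close>

definition rest :: "'b \<Rightarrow> 'b \<Rightarrow> 'b \<Rightarrow> 'b" where
  "rest x y w = w - scale (f w y) x - scale (f x w) y"

lemma hyperbolic_pair:
  assumes "x \<in> W" "x \<noteq> 0"
  obtains y where "y \<in> W" "f x y = 1"
proof -
  obtain z where z: "z \<in> W" "f x z \<noteq> 0"
    using nondegenerate assms by blast
  then show ?thesis
    using that[of "scale (inverse (f x z)) z"] assms by (simp add: scale_right)
qed

context
  fixes x y
  assumes x: "x \<in> W" and y: "y \<in> W" and pair: "f x y = 1"
begin

lemma pair': "f y x = - 1"
  using skew[OF y x] pair by simp

lemma perp_subset: "perp x y \<subseteq> W"
  by (auto simp: perp_def)

lemma perp_0: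
  assumes "r \<in> perp x y"
  shows "r \<in> W" "f x r = 0" "f y r = 0" "f r x = 0" "f r y = 0"
  using assms x y skew[of r x] skew[of r y] by (auto simp: perp_def)

lemma rest_in_perp: "w \<in> W \<Longrightarrow> rest x y w \<in> perp x y"
  using skew[of w y] by (simp add: perp_def rest_def expand x y pair pair')

lemma rest_add: "v \<in> W \<Longrightarrow> w \<in> W \<Longrightarrow> rest x y (v + w) = rest x y v + rest x y w"
  by (simp add: rest_def expand x y scale_left_distrib)

lemma rest_scale: "w \<in> W \<Longrightarrow> rest x y (scale c w) = scale c (rest x y w)"
  by (simp add: rest_def expand x y scale_right_diff_distrib)

lemma decomposition: "w = scale (f w y) x + scale (f x w) y + rest x y w"
  by (simp add: rest_def)

lemma form_decomposed:
  assumes "r \<in> perp x y" "s \<in> perp x y"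
  shows "f (scale c x + scale d y + r) (scale c' x + scale d' y + s) = c * d' - d * c' + f r s"
  using perp_0[OF assms(1)] perp_0[OF assms(2)]
  by (simp add: expand x y pair pair' algebra_simps)

lemma form_rest:
  assumes "v \<in> W" "w \<in> W"
  shows "f v w = f v y * f x w - f x v * f w y + f (rest x y v) (rest x y w)"
  using form_decomposed[OF rest_in_perp[OF assms(1)] rest_in_perp[OF assms(2)],
      of "f v y" "f x v" "f w y" "f x w"]
  by (simp flip: decomposition)

text \<open>A vector of the complement pairs with \<open>w\<close> as with the projection of
  \<open>w\<close>, so nondegeneracy is inherited from \<open>W\<close>.\<close>

lemma symplectic_subspace_perp: "symplectic_subspace scale (perp x y) f"
proof unfold_locales
  show "subspace (perp x y)"
    by (auto simp: subspace_def perp_def expand x y)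
       (use x y alternating scale_right[of _ 0 0] in auto)
  show "finite (perp x y)"
    using finite_subset[OF perp_subset finite_W] .
  fix r assume r: "r \<in> perp x y" and zero: "\<And>s. s \<in> perp x y \<Longrightarrow> f r s = 0"
  show "r = 0"
  proof (rule nondegenerate)
    fix w assume w: "w \<in> W"
    have "f r w = f r (rest x y w)"
      using perp_0[OF r] w form_rest[of r w] by (simp add: rest_def)
    then show "f r w = 0"
      using zero rest_in_perp[OF w] by simp
  qed (use perp_0[OF r] in simp)
qed (auto simp: perp_def expand)

text \<open>The coefficients of \<open>x\<close> and \<open>y\<close> are recovered by pairing with
  \<open>y\<close> and \<open>x\<close>. Hence spaces of equal size have complements of equal
  size.\<close>

lemma card_perp: "card W = CARD('a) * (CARD('a) * card (perp x y))"
proof -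
  let ?g = "\<lambda>(c, d, r). scale c x + scale d y + r"
  have coords: "f (scale c x + scale d y + r) y = c" "f x (scale c x + scale d y + r) = d"
    if "r \<in> perp x y" for c d r
    using perp_0[OF that] by (simp_all add: expand x y pair)
  have "W = ?g ` (UNIV \<times> UNIV \<times> perp x y)"
  proof (intro equalityI subsetI)
    fix w assume "w \<in> W"
    then show "w \<in> ?g ` (UNIV \<times> UNIV \<times> perp x y)"
      by (intro image_eqI[of _ _ "(f w y, f x w, rest x y w)"]) (use decomposition rest_in_perp in auto)
  qed (use perp_subset x y in auto)
  moreover have "inj_on ?g (UNIV \<times> UNIV \<times> perp x y)"
  proof (rule inj_onI)
    fix u v assume uv: "u \<in> UNIV \<times> UNIV \<times> perp x y" "v \<in> UNIV \<times> UNIV \<times> perp x y" "?g u = ?g v"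
    obtain c d r c' d' r' where u: "u = (c, d, r)" and v: "v = (c', d', r')"
      by (cases u, cases v) auto
    have r: "r \<in> perp x y" "r' \<in> perp x y"
      and eq: "scale c x + scale d y + r = scale c' x + scale d' y + r'"
      using uv by (simp_all add: u v)
    have "c = c'" "d = d'"
      using coords[OF r(1), of c d] coords[OF r(2), of c' d'] unfolding eq by simp_all
    then show "u = v"
      using eq by (simp add: u v)
  qed
  ultimately have "card W = card (UNIV \<times> UNIV \<times> perp x y :: ('a \<times> 'a \<times> 'b) set)"
    by (metis card_image)
  then show ?thesis
    by (simp add: card_cartesian_product)
qed

end

end

text \<open>A form-preserving linear map into \<open>W2\<close>; between symplectic subspaces of
  equal size, nondegeneracy makes it bijective.\<close>

definition isometry ::
  "('a \<Rightarrow> 'b \<Rightarrow> 'b) \<Rightarrow> 'b set \<Rightarrow> ('b \<Rightarrow> 'b \<Rightarrow> 'a) \<Rightarrow>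
   ('a \<Rightarrow> 'c \<Rightarrow> 'c) \<Rightarrow> 'c set \<Rightarrow> ('c \<Rightarrow> 'c \<Rightarrow> 'a) \<Rightarrow>
   ('b::ab_group_add \<Rightarrow> 'c::ab_group_add) \<Rightarrow> bool" where
  "isometry s1 W1 f1 s2 W2 f2 g \<longleftrightarrow> g ` W1 \<subseteq> W2 \<and>
     (\<forall>x\<in>W1. \<forall>y\<in>W1. g (x + y) = g x + g y \<and> f2 (g x) (g y) = f1 x y) \<and>
     (\<forall>c. \<forall>x\<in>W1. g (s1 c x) = s2 c (g x))"

text \<open>Vectors with equal images pair equally with everything in \<open>W1\<close>.\<close>

lemma isometry_inj_on:
  assumes "symplectic_subspace s1 W1 f1" "symplectic_subspace s2 W2 f2"
    and g: "isometry s1 W1 f1 s2 W2 f2 g"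
  shows "inj_on g W1"
proof (rule inj_onI)
  interpret S1: symplectic_subspace s1 W1 f1 by fact
  interpret S2: symplectic_subspace s2 W2 f2 by fact
  fix x y assume xy: "x \<in> W1" "y \<in> W1" "g x = g y"
  have "x - y = 0"
  proof (rule S1.nondegenerate)
    fix z assume z: "z \<in> W1"
    have "f1 x z = f1 y z"
      using g xy z unfolding isometry_def by metis
    then show "f1 (x - y) z = 0"
      using xy z by (simp add: S1.diff_left)
  qed (use xy in simp)
  then show "x = y" by simp
qed

text \<open>Induction on the size: a hyperbolic pair is split off on each side, and an isometry of
  the complements is extended.\<close>

lemma isometry_exists:
  fixes s1 :: "'a::{field,finite} \<Rightarrow> 'b::ab_group_add \<Rightarrow> 'b"
    and s2 :: "'a \<Rightarrow> 'c::ab_group_add \<Rightarrow> 'c"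
  assumes "symplectic_subspace s1 W1 f1" "symplectic_subspace s2 W2 f2" "card W1 = card W2"
  shows "\<exists>g. isometry s1 W1 f1 s2 W2 f2 g"
  using assms
proof (induction "card W1" arbitrary: W1 W2 rule: less_induct)
  case less
  interpret S1: symplectic_subspace s1 W1 f1 by fact
  interpret S2: symplectic_subspace s2 W2 f2 by fact
  show ?case
  proof (cases "W1 = {0}")
    case True
    then have "isometry s1 W1 f1 s2 W2 f2 (\<lambda>_. 0)"
      using S1.alternating[of 0] S2.alternating[of 0] by (simp add: isometry_def)
    then show ?thesis by blast
  next
    case False
    then obtain x where x: "x \<in> W1" "x \<noteq> 0"
      using S1.W_closed(4) by blast
    obtain y where y: "y \<in> W1" "f1 x y = 1"
      using S1.hyperbolic_pair[OF x] .
    have "W2 \<noteq> {0}"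
    proof
      assume "W2 = {0}"
      then have "card W1 = 1"
        using less.prems(3) by simp
      then show False
        using x S1.W_closed(4) by (auto simp: card_1_singleton_iff)
    qed
    then obtain x' where x': "x' \<in> W2" "x' \<noteq> 0"
      using S2.W_closed(4) by blast
    obtain y' where y': "y' \<in> W2" "f2 x' y' = 1"
      using S2.hyperbolic_pair[OF x'] .
    note pair1 = x(1) y and pair2 = x'(1) y'
    let ?P1 = "S1.perp x y" and ?P2 = "S2.perp x' y'"
    have card: "card W1 = CARD('a) * (CARD('a) * card ?P1)" "card W2 = CARD('a) * (CARD('a) * card ?P2)"
      using S1.card_perp[OF pair1] S2.card_perp[OF pair2] .
    have "?P1 \<subset> W1"
      using S1.perp_subset[OF pair1] S1.perp_0(2)[OF pair1, of y] y by auto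
    then have "card ?P1 < card W1"
      using S1.finite_W by (rule psubset_card_mono[rotated])
    moreover have "card ?P1 = card ?P2"
      using card less.prems(3) by simp
    ultimately obtain h where h: "isometry s1 ?P1 f1 s2 ?P2 f2 h"
      using less.hyps S1.symplectic_subspace_perp[OF pair1] S2.symplectic_subspace_perp[OF pair2]
      by blast
    \<comment> \<open>This sends \<open>x\<close> to \<open>x'\<close> and \<open>y\<close> to
      \<open>y'\<close> and agrees with \<open>h\<close> on the complement.\<close>
    define g where "g w = s2 (f1 w y) x' + s2 (f1 x w) y' + h (S1.rest x y w)" for w
    note rest = S1.rest_in_perp[OF pair1]
    have h_perp: "h (S1.rest x y w) \<in> ?P2" if "w \<in> W1" for w
      using h rest[OF that] by (auto simp: isometry_def)
    have "isometry s1 W1 f1 s2 W2 f2 g"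
      unfolding isometry_def
    proof (intro conjI ballI allI)
      show "g ` W1 \<subseteq> W2"
        using h_perp[THEN subsetD[OF S2.perp_subset[OF pair2]]] x' y' by (auto simp: g_def)
    next
      fix u v assume uv: "u \<in> W1" "v \<in> W1"
      have "h (S1.rest x y (u + v)) = h (S1.rest x y u) + h (S1.rest x y v)"
        using h rest uv by (simp add: S1.rest_add[OF pair1] isometry_def)
      then show "g (u + v) = g u + g v"
        using uv x y by (simp add: g_def S1.expand S2.scale_left_distrib)
      have "f2 (h (S1.rest x y u)) (h (S1.rest x y v)) = f1 (S1.rest x y u) (S1.rest x y v)"
        using h rest uv by (simp add: isometry_def)
      then show "f2 (g u) (g v) = f1 u v"
        unfolding g_def S2.form_decomposed[OF pair2 h_perp[OF uv(1)] h_perp[OF uv(2)]]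
        by (simp add: S1.form_rest[OF pair1 uv])
    next
      fix c w assume w: "w \<in> W1"
      have "h (S1.rest x y (s1 c w)) = s2 c (h (S1.rest x y w))"
        using h rest w by (simp add: S1.rest_scale[OF pair1] isometry_def)
      then show "g (s1 c w) = s2 c (g w)"
        using w x y by (simp add: g_def S1.expand S2.scale_right_distrib)
    qed
    then show ?thesis by blast
  qed
qed

section \<open>Transport to an arbitrary symplectic space\<close>

lemma frobenius_alg_closure:
  assumes "1 \<le> m"
  obtains a :: "'a::{field,finite} alg_closure" where "frobenius CARD('a) a m"
proof -
  let ?q = "CARD('a)"
  have q: "2 \<le> ?q"
    by (rule card_finite_field_ge_2)
  have gt: "1 < ?q ^ m"
    using q assms by (intro one_less_power) auto
  \<comment> \<open>A root of X^(q^m - 1) + 1, with q the order of \<open>'a\<close>: multiplying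
    the equation by \<open>a\<close> gives the required conjugate \<open>- a\<close>.\<close>
  then obtain a :: "'a alg_closure" where a: "a ^ (?q ^ m - 1) = - 1"
    using nth_root_exists[of "?q ^ m - 1" "- 1 :: 'a alg_closure"] by auto
  have "a \<noteq> 0"
    using a gt by (auto simp: power_0_left)
  moreover have "a ^ (?q ^ m) = - a"
    using a gt power_Suc[of a "?q ^ m - 1"] by simp
  ultimately show ?thesis
    using that q assms alg_closure_power_card_add alg_closure_of_nat_card
    by (metis frobenius.intro)
qed

text \<open>Elements of \<open>'a\<close> are fixed by the \<open>q\<close>-power map, and both sets
  have \<open>q\<close> elements.\<close>

lemma to_ac_range_F:
  assumes "frobenius CARD('a::{field,finite}) (a :: 'a alg_closure) m"
  shows "range (to_ac :: 'a \<Rightarrow> _) = frobenius.F CARD('a) 1"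
proof -
  interpret frobenius "CARD('a)" a m by fact
  have "(to_ac c :: 'a alg_closure) \<in> F 1" for c :: 'a
    by (simp add: F_def finite_field_power_card flip: to_ac_power)
  then have "range to_ac \<subseteq> F 1"
    by blast
  then show ?thesis
    using card_F[of 1] by (intro card_subset_eq) (simp_all add: card_image inj_to_ac)
qed

definition scale_pair :: "'a::field \<Rightarrow> 'a alg_closure \<times> 'a alg_closure \<Rightarrow> 'a alg_closure \<times> 'a alg_closure" where
  "scale_pair c v = (to_ac c * fst v, to_ac c * snd v)"

text \<open>\<open>of_ac\<close> inverts \<open>to_ac\<close> on \<open>F 1\<close>, where all
  values of \<open>tform\<close> on \<open>K \<times> K\<close> lie, so it is linear on these
  values.\<close>

lemma symplectic_subspace_tform:
  assumes "frobenius CARD('a::{field,finite}) (a :: 'a alg_closure) m"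
  shows "symplectic_subspace scale_pair
    (frobenius.F CARD('a) (2 * m) \<times> frobenius.F CARD('a) (2 * m))
    (\<lambda>v w. of_ac (frobenius.tform CARD('a) a m v w))"
proof -
  interpret frobenius "CARD('a)" a m by fact
  have range: "range (to_ac :: 'a \<Rightarrow> _) = F 1"
    by (rule to_ac_range_F) fact
  have to_ac_F1: "(to_ac c :: 'a alg_closure) \<in> F 1" for c :: 'a
    using range by blast
  have to_ac_K: "(to_ac c :: 'a alg_closure) \<in> K" for c :: 'a
    using to_ac_F1 F_mono[of 1 "2 * m"] by auto
  have of_ac: "to_ac (of_ac z :: 'a) = z" if "z \<in> F 1" for z
    using that range by (auto intro: to_ac_of_ac)
  have of_ac_add: "(of_ac (x + y) :: 'a) = of_ac x + of_ac y" if "x \<in> F 1" "y \<in> F 1" for x y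
    using that by (intro of_ac_eqI) (simp add: of_ac)
  have of_ac_scale: "of_ac (to_ac c * x) = c * of_ac x" if "x \<in> F 1" for c :: 'a and x
    using that by (intro of_ac_eqI) (simp add: of_ac)
  have skew: "tform v w = - tform w v" for v w
    unfolding tform_def trace_uminus[symmetric] by (simp add: cdet_def algebra_simps)
  interpret V: vector_space "scale_pair :: 'a \<Rightarrow> _"
    by unfold_locales (simp_all add: scale_pair_def prod_eq_iff algebra_simps)
  show ?thesis
  proof unfold_locales
    show "V.subspace (K \<times> K)"
      by (auto simp: V.subspace_def scale_pair_def zero_prod_def intro!: F_add F_mult to_ac_K)
    show "finite (K \<times> K)"
      using card_K by simp
  next
    fix x y z assume *: "x \<in> K \<times> K" "y \<in> K \<times> K" "z \<in> K \<times> K"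
    show "of_ac (tform (x + y) z) = of_ac (tform x z) + (of_ac (tform y z) :: 'a)"
      unfolding tform_add_left using * by (intro of_ac_add tform_in_F)
    have "tform x (y + z) = tform x y + tform x z"
      using tform_add_left[of y z x] by (simp add: skew[of x])
    then show "of_ac (tform x (y + z)) = of_ac (tform x y) + (of_ac (tform x z) :: 'a)"
      using of_ac_add[OF tform_in_F[OF *(1,2)] tform_in_F[OF *(1,3)]] by (simp only:)
  next
    fix c :: 'a and x z assume *: "x \<in> K \<times> K" "z \<in> K \<times> K"
    show "of_ac (tform (scale_pair c x) z) = c * of_ac (tform x z)"
      unfolding scale_pair_def tform_scale_left[OF to_ac_F1]
      using * by (intro of_ac_scale tform_in_F)
  next
    fix x assume "x \<in> K \<times> K"
    show "of_ac (tform x x) = (0 :: 'a)"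
      by (simp add: tform_alternating)
  next
    fix x assume x: "x \<in> K \<times> K" and zero: "\<And>y. y \<in> K \<times> K \<Longrightarrow> of_ac (tform x y) = (0 :: 'a)"
    show "x = 0"
      using x
    proof (rule tform_nondegenerate)
      fix w assume w: "w \<in> K \<times> K"
      show "tform x w = 0"
        using zero[OF w] of_ac[OF tform_in_F[OF x w]] by simp
    qed
  qed
qed

lemma (in Sp_space) finite_UNIV_space: "finite (UNIV :: 'b set)"
proof -
  obtain B where B: "independent B" "UNIV \<subseteq> span B"
    using basis_exists[of UNIV] by blast
  obtain A where A: "finite A" "span A = UNIV"
    using finite_spanning by blast
  have "finite B"
    using independent_span_bound[OF A(1) B(1)] A(2) by simp
  then have "card (span B) = CARD('a) ^ card B"
    using card_span_independent B(1) by blast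
  moreover have "span B = UNIV"
    using B(2) by blast
  \<comment> \<open>An infinite set has \<open>card\<close> 0, so a positive value proves
    finiteness.\<close>
  ultimately have "0 < card (UNIV :: 'b set)"
    by simp
  then show ?thesis
    by (rule card_ge_0_finite)
qed

lemma (in Sp_space) symplectic_subspace_UNIV: "symplectic_subspace scale UNIV form"
proof unfold_locales
  fix c x y z
  interpret left: Vector_Spaces.linear scale "(*)" "\<lambda>x. form x z"
    by (rule form_linear_left)
  interpret right: Vector_Spaces.linear scale "(*)" "\<lambda>y. form x y"
    by (rule form_linear_right)
  show "form (x + y) z = form x z + form y z"
    by (rule left.add)
  show "form x (y + z) = form x y + form x z"
    by (rule right.add)
  show "form (scale c x) z = c * form x z"
    by (rule left.scale)
qed (use form_alternating form_nondegenerate finite_UNIV_space in auto)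

theorem theorem3p1:
  fixes scale :: "'a::{field,finite} \<Rightarrow> 'b::ab_group_add \<Rightarrow> 'b"
    and form :: "'b \<Rightarrow> 'b \<Rightarrow> 'a"
    and m q :: nat
  assumes "m \<ge> 1"
    and "Sp_space scale form (2 * m) q"
  shows "\<exists>S. Sp_space.maximal_symplectic_partial_spread scale form (2 * m) S \<and>
             card S = q ^ (2 * m) - q ^ m + gcd 2 (q - 1)"
proof -
  interpret Sp_space scale form "2 * m" q by fact
  obtain a :: "'a alg_closure" where frob: "frobenius q a m"
    using frobenius_alg_closure[OF assms(1)] field_order by blast
  interpret frobenius q a m by fact
  let ?f = "\<lambda>v w. of_ac (tform v w) :: 'a"
  have VV: "symplectic_subspace scale UNIV form"
    by (rule symplectic_subspace_UNIV)
  have KK: "symplectic_subspace scale_pair (K \<times> K) ?f"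
    using symplectic_subspace_tform[of a m] frob unfolding field_order by blast
  \<comment> \<open>The half-dimension is \<open>2 * m\<close>, so the space has dimension
    \<open>4 * m\<close> and the size of \<open>K \<times> K\<close>.\<close>
  have "card (UNIV :: 'b set) = q ^ (2 * (2 * m))"
    using card_eq_power_dim[OF subspace_UNIV finite_UNIV_space] dim_space field_order by simp
  also have "\<dots> = card (K \<times> K)"
    by (simp add: card_cartesian_product card_K flip: power_add)
  finally have cards: "card (UNIV :: 'b set) = card (K \<times> K)" .
  then obtain g where g: "isometry scale UNIV form scale_pair (K \<times> K) ?f g"
    using isometry_exists[OF VV KK] by blast
  have inj: "inj g"
    using isometry_inj_on[OF VV KK g] .
  have range: "range g = K \<times> K"
    using g card_K(2) cards by (intro card_subset_eq) (simp_all add: isometry_def card_image[OF inj])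
  have g_add: "g (x + y) = g x + g y" and g_form: "?f (g x) (g y) = form x y"
    and g_scale: "g (scale c x) = (to_ac c * fst (g x), to_ac c * snd (g x))" for c x y
    using g by (simp_all add: isometry_def scale_pair_def)
  have g_0: "g 0 = 0"
    using g_add[of 0 0] by simp
  have F1: "F 1 = range (to_ac :: 'a \<Rightarrow> _)"
    using to_ac_range_F[of a m] frob field_order by simp
  have g_tform: "tform (g x) (g y) = 0 \<longleftrightarrow> form x y = 0" for x y
  proof -
    have "tform (g x) (g y) \<in> range (to_ac :: 'a \<Rightarrow> _)"
      unfolding F1[symmetric] using range by (intro tform_in_F) auto
    then have "to_ac (form x y) = tform (g x) (g y)"
      unfolding g_form[symmetric] by (rule to_ac_of_ac)
    then show ?thesis
      by (metis to_ac_eq_0_iff)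
  qed
  have vimage_image: "g -` g ` T = T" for T
    using inj by (rule inj_vimage_image_eq)
  have image_vimage: "g ` (g -` U) = U" if "U \<subseteq> K \<times> K" for U
    using that by (simp add: image_vimage_eq range Int_absorb2)
  \<comment> \<open>Each clause of \<open>tispace\<close> is carried over by the isometry
    \<open>g\<close>; size and dimension determine each other because \<open>q\<close> is at least
    2.\<close>
  have member_iff: "subspace T \<and> dim T = 2 * m \<and> totally_isotropic T \<longleftrightarrow> tispace (g ` T)" for T
  proof -
    have zero: "0 \<in> g ` T \<longleftrightarrow> 0 \<in> T"
      using inj g_0 by (metis inj_image_mem_iff)
    have add: "(\<forall>v\<in>g ` T. \<forall>w\<in>g ` T. v + w \<in> g ` T) \<longleftrightarrow> (\<forall>x\<in>T. \<forall>y\<in>T. x + y \<in> T)"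
      by (simp add: inj_image_mem_iff[OF inj] flip: g_add)
    have scl: "(\<forall>c\<in>F 1. \<forall>v\<in>g ` T. (c * fst v, c * snd v) \<in> g ` T) \<longleftrightarrow> (\<forall>c. \<forall>x\<in>T. scale c x \<in> T)"
      unfolding F1 by (simp add: inj_image_mem_iff[OF inj] flip: g_scale)
    have iso: "(\<forall>v\<in>g ` T. \<forall>w\<in>g ` T. tform v w = 0) \<longleftrightarrow> totally_isotropic T"
      by (simp add: totally_isotropic_def g_tform)
    have "card (g ` T) = card T"
      using inj by (metis card_image inj_on_subset subset_UNIV)
    moreover have "card T = q ^ dim T" if "subspace T"
      using card_eq_power_dim[OF that] finite_subset[OF _ finite_UNIV_space] field_order by simp
    ultimately have "card (g ` T) = q ^ (2 * m) \<longleftrightarrow> dim T = 2 * m" if "subspace T"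
      using that q_ge_2 by simp
    moreover have "g ` T \<subseteq> K \<times> K"
      unfolding range[symmetric] by blast
    ultimately show ?thesis
      unfolding tispace_def zero add scl iso subspace_def by blast
  qed
  define S where "S = (\<lambda>U. g -` U) ` spread"
  have spread_KK: "U \<subseteq> K \<times> K" if "U \<in> spread" for U
    using tispace_spread[OF that] by (simp add: tispace_def)
  have "inj_on (\<lambda>U. g -` U) spread"
    by (intro inj_onI) (metis image_vimage spread_KK)
  then have "card S = q ^ (2 * m) - q ^ m + gcd 2 (q - 1)"
    unfolding S_def by (simp add: card_image card_spread)
  moreover have "symplectic_partial_spread S"
    unfolding symplectic_partial_spread_def
  proof (intro conjI ballI impI)
    fix T assume "T \<in> S"
    then obtain U where "U \<in> spread" "T = g -` U"
      by (auto simp: S_def)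
    then have "tispace (g ` T)"
      using image_vimage spread_KK tispace_spread by simp
    then show "subspace T" "dim T = 2 * m" "totally_isotropic T"
      using member_iff by blast+
  next
    fix T T' assume "T \<in> S" "T' \<in> S" "T \<noteq> T'"
    then obtain U U' where U: "U \<in> spread" "T = g -` U" "U' \<in> spread" "T' = g -` U'" "U \<noteq> U'"
      by (auto simp: S_def)
    then have "T \<inter> T' = g -` {0}"
      using spread_disjoint by (metis vimage_Int)
    also have "\<dots> = {0}"
      using vimage_image[of "{0}"] g_0 by simp
    finally show "T \<inter> T' = {0}" .
  qed
  \<comment> \<open>The image of an additional member would meet every member of
    \<open>spread\<close> only in 0, and so belong to \<open>spread\<close> itself.\<close>
  moreover have False if T: "symplectic_partial_spread T" "S \<subset> T" for T
  proof -
    obtain Y where Y: "Y \<in> T" "Y \<notin> S"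
      using T(2) by blast
    have "tispace (g ` Y)"
      using T(1) Y(1) member_iff unfolding symplectic_partial_spread_def by blast
    moreover have "g ` Y \<inter> U = {0}" if U: "U \<in> spread" for U
    proof -
      have "g -` U \<in> S"
        using U by (auto simp: S_def)
      then have "g -` U \<in> T" "Y \<noteq> g -` U"
        using T(2) Y(2) by blast+
      then have "Y \<inter> g -` U = {0}"
        using T(1) Y(1) by (simp add: symplectic_partial_spread_def)
      moreover have "g ` Y \<inter> g ` (g -` U) = g ` (Y \<inter> g -` U)"
        by (rule image_Int[OF inj, symmetric])
      ultimately show ?thesis
        using g_0 by (simp only: image_vimage[OF spread_KK[OF U]] image_insert image_empty)
    qed
    ultimately have "g ` Y \<in> spread"
      by (rule spread_maximal)
    then have "g -` g ` Y \<in> S"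
      unfolding S_def by (rule imageI)
    then show False
      using Y(2) by (simp only: vimage_image)
  qed
  ultimately show ?thesis
    unfolding maximal_symplectic_partial_spread_def by blast
qed

end
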